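(* Let $X$ be an Archimedean vector lattice and let $Y$ be a regular sublattice of $X$. Then the order completion $Y^\delta$ is a regular sublattice of the order completion $X^\delta$; that is, the inclusion $Y\hookrightarrow X\subseteq X^\delta$ extends to an injective lattice homomorphism $Y^\delta\to X^\delta$ whose range is a regular sublattice of $X^\delta$.
   Context: All vector lattices are real and Archimedean. A sublattice is a linear subspace closed under the lattice operations. A sublattice $Y$ of a vector lattice $X$ is called regular if for every subset $A$ of $Y$ whose infimum exists in $Y$, the infimum of $A$ exists in $X$ and equals the infimum in $Y$. The order (Dedekind) completion $X^\delta$ of $X$ is the unique (up to lattice isomorphism) order complete vector lattice that contains $X$ as an order dense and majorizing sublattice. Order dense: for every $0<x\in X^\delta$ there is $y\in X$ with $0<y\le x$. Majorizing: for every $x\in X^\delta$ with $x>0$ there is $y\in X$ with $x\le y$. *)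

theory Defs
  imports "HOL-Library.Lub_Glb"
begin

class vector_lattice = ordered_real_vector + lattice

class archimedean_vector_lattice = vector_lattice +
  assumes archimedean: "(\<And>n::nat. real n *\<^sub>R x \<le> y) \<Longrightarrow> x \<le> 0"

text \<open>
  Order complete: every nonempty order bounded above (below) set has a supremum (infimum). Such
  lattices are automatically Archimedean.
\<close>

class order_complete_vector_lattice = vector_lattice + conditionally_complete_lattice

definition sublattice :: "'a::vector_lattice set \<Rightarrow> bool" where
  "sublattice Y \<longleftrightarrow> subspace Y \<and> (\<forall>x\<in>Y. \<forall>y\<in>Y. sup x y \<in> Y \<and> inf x y \<in> Y)"

text \<open>
  \<open>isGlb Y A a\<close> says that \<open>a\<close> is the infimum of \<open>A\<close> computed in \<open>Y\<close>. The set \<open>A\<close> may be empty;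
  its infimum exists in \<open>Y\<close> only if \<open>Y = {0}\<close>. So, taken literally, \<open>{0}\<close> is regular only in the
  zero space, and for all other \<open>Y\<close> the empty set is irrelevant.
\<close>

definition regular_sublattice :: "'a::vector_lattice set \<Rightarrow> bool" where
  "regular_sublattice Y \<longleftrightarrow>
     sublattice Y \<and> (\<forall>A\<subseteq>Y. \<forall>a. isGlb Y A a \<longrightarrow> isGlb UNIV A a)"

definition lattice_hom_on :: "'a::vector_lattice set \<Rightarrow> ('a \<Rightarrow> 'b::vector_lattice) \<Rightarrow> bool" where
  "lattice_hom_on S f \<longleftrightarrow>
     (\<forall>x\<in>S. \<forall>y\<in>S. f (x + y) = f x + f y) \<and>
     (\<forall>r. \<forall>x\<in>S. f (r *\<^sub>R x) = r *\<^sub>R f x) \<and>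
     (\<forall>x\<in>S. \<forall>y\<in>S. f (sup x y) = sup (f x) (f y)) \<and>
     (\<forall>x\<in>S. \<forall>y\<in>S. f (inf x y) = inf (f x) (f y))"

definition order_dense :: "'a::vector_lattice set \<Rightarrow> bool" where
  "order_dense S \<longleftrightarrow> (\<forall>x>0. \<exists>y\<in>S. 0 < y \<and> y \<le> x)"

definition majorizing :: "'a::vector_lattice set \<Rightarrow> bool" where
  "majorizing S \<longleftrightarrow> (\<forall>x>0. \<exists>y\<in>S. x \<le> y)"

text \<open>
  The order completion is determined only up to lattice isomorphism, so it is represented by an
  order complete type \<open>'b\<close> with an embedding \<open>\<iota>\<close> of the vector lattice \<open>S\<close>, here a sublattice of
  a type. Values of \<open>\<iota>\<close> outside \<open>S\<close> are irrelevant.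
\<close>

definition order_completion ::
    "'a::vector_lattice set \<Rightarrow> ('a \<Rightarrow> 'b::order_complete_vector_lattice) \<Rightarrow> bool" where
  "order_completion S \<iota> \<longleftrightarrow>
     sublattice S \<and> lattice_hom_on S \<iota> \<and> inj_on \<iota> S \<and>
     order_dense (\<iota> ` S) \<and> majorizing (\<iota> ` S)"

end

theory Submission
  imports Defs "HOL-Library.Lattice_Algebras"
begin

text \<open>
  Extend \<open>\<iota>\<^sub>X\<close> from \<open>Y\<close> to its completion by mapping \<open>z\<close> to the infimum of \<open>\<iota>\<^sub>X u\<close> over all
  \<open>u \<in> Y\<close> above \<open>z\<close>. In the completion the differences \<open>u - l\<close> of elements \<open>u \<ge> z \<ge> l\<close> of \<open>Y\<close>
  have infimum \<open>0\<close>, and regularity of \<open>Y\<close> in \<open>X\<close> and of \<open>X\<close> in its completion transports this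
  infimum to the differences \<open>\<iota>\<^sub>X u - \<iota>\<^sub>X l\<close>. Hence the value at \<open>z\<close> is the only element that
  separates the \<open>\<iota>\<^sub>X l\<close> from the \<open>\<iota>\<^sub>X u\<close>, and every algebraic property of the extension follows from
  this uniqueness. Regularity of the range holds because a set with infimum \<open>0\<close> in the completion
  of \<open>Y\<close> can be replaced by the set of all elements of \<open>Y\<close> above one of its members.
\<close>

\<comment> \<open>Infima, the Archimedean property, sublattices and lattice homomorphisms\<close>
subclass (in vector_lattice) lattice_ab_group_add ..

lemma isGlb_iff:
  "isGlb Y A a \<longleftrightarrow> a \<in> Y \<and> (\<forall>x\<in>A. a \<le> x) \<and> (\<forall>b\<in>Y. (\<forall>x\<in>A. b \<le> x) \<longrightarrow> b \<le> a)"
  unfolding isGlb_def greatestP_def isLb_def setge_def setle_def by auto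

lemma isGlb_greatest:
  "isGlb UNIV A a \<Longrightarrow> (\<And>x. x \<in> A \<Longrightarrow> b \<le> x) \<Longrightarrow> b \<le> a"
  by (simp add: isGlb_iff)

text \<open>Let \<open>s\<close> be the supremum of the multiples of \<open>x\<close>. From
  \<open>(n + 1) x\<close> \<le> \<open>s\<close> it follows that \<open>n x\<close> \<le>
  \<open>s - x\<close>, so \<open>s - x\<close> is again an upper bound.\<close>

lemma order_complete_archimedean:
  fixes x y :: "'c::order_complete_vector_lattice"
  assumes "\<And>n::nat. real n *\<^sub>R x \<le> y"
  shows "x \<le> 0"
proof -
  let ?M = "range (\<lambda>n::nat. real n *\<^sub>R x)"
  have bdd: "bdd_above ?M"
    unfolding bdd_above_def using assms by auto
  have "Sup ?M \<le> Sup ?M - x"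
  proof (rule cSup_least)
    fix v assume "v \<in> ?M"
    then obtain n :: nat where v: "v = real n *\<^sub>R x" by auto
    have "real (Suc n) *\<^sub>R x \<le> Sup ?M"
      using bdd by (intro cSup_upper) blast+
    then show "v \<le> Sup ?M - x"
      by (simp add: v scaleR_left_distrib algebra_simps)
  qed simp
  then show ?thesis by (simp add: algebra_simps)
qed

text \<open>Serves \<open>extension_sup\<close>: it controls the error in a supremum when both
  arguments are replaced by approximations from above.\<close>

lemma sup_diff_le:
  fixes a a' b b' :: "'a::lattice_ab_group_add"
  assumes "a' \<le> a" "b' \<le> b"
  shows "sup a b \<le> sup a' b' + (a - a') + (b - b')"
proof (rule sup_least)
  have "a' + (a - a') + 0 \<le> sup a' b' + (a - a') + (b - b')"
    using assms by (intro add_mono) auto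
  then show "a \<le> sup a' b' + (a - a') + (b - b')" by simp
  have "b' + 0 + (b - b') \<le> sup a' b' + (a - a') + (b - b')"
    using assms by (intro add_mono) auto
  then show "b \<le> sup a' b' + (a - a') + (b - b')" by simp
qed

lemma sublatticeD:
  assumes "sublattice Y"
  shows "0 \<in> Y"
    and "x \<in> Y \<Longrightarrow> y \<in> Y \<Longrightarrow> x + y \<in> Y"
    and "x \<in> Y \<Longrightarrow> r *\<^sub>R x \<in> Y"
    and "x \<in> Y \<Longrightarrow> y \<in> Y \<Longrightarrow> x - y \<in> Y"
    and "x \<in> Y \<Longrightarrow> - x \<in> Y"
    and "x \<in> Y \<Longrightarrow> y \<in> Y \<Longrightarrow> sup x y \<in> Y"
    and "x \<in> Y \<Longrightarrow> y \<in> Y \<Longrightarrow> inf x y \<in> Y"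
  using assms unfolding sublattice_def
  by (auto intro: subspace_0 subspace_add subspace_scale subspace_diff subspace_neg)

lemma lattice_hom_onD:
  assumes "lattice_hom_on S f"
  shows "x \<in> S \<Longrightarrow> y \<in> S \<Longrightarrow> f (x + y) = f x + f y"
    and "x \<in> S \<Longrightarrow> f (r *\<^sub>R x) = r *\<^sub>R f x"
    and "x \<in> S \<Longrightarrow> y \<in> S \<Longrightarrow> f (sup x y) = sup (f x) (f y)"
    and "x \<in> S \<Longrightarrow> y \<in> S \<Longrightarrow> f (inf x y) = inf (f x) (f y)"
  using assms unfolding lattice_hom_on_def by auto

lemma lattice_hom_on_uminus:
  assumes "lattice_hom_on S f" "x \<in> S"
  shows "f (- x) = - f x"
  using lattice_hom_onD(2)[OF assms, of "-1"] by simp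

lemma lattice_hom_on_zero:
  assumes "lattice_hom_on S f" "sublattice S"
  shows "f 0 = 0"
  using lattice_hom_onD(2)[OF assms(1) sublatticeD(1)[OF assms(2)], of 0] by simp

lemma lattice_hom_on_diff:
  assumes "lattice_hom_on S f" "sublattice S" "x \<in> S" "y \<in> S"
  shows "f (x - y) = f x - f y"
  using lattice_hom_onD(1)[OF assms(1,3) sublatticeD(5)[OF assms(2,4)]]
    lattice_hom_on_uminus[OF assms(1,4)] by simp

lemma lattice_hom_on_mono:
  assumes "lattice_hom_on S f" "x \<in> S" "y \<in> S" "x \<le> y"
  shows "f x \<le> f y"
  using lattice_hom_onD(3)[OF assms(1-3)] assms(4) by (metis sup.absorb_iff2)

lemma lattice_hom_on_le_iff:
  assumes "lattice_hom_on S f" "sublattice S" "inj_on f S" "x \<in> S" "y \<in> S"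
  shows "f x \<le> f y \<longleftrightarrow> x \<le> y"
proof
  assume "f x \<le> f y"
  then have "f (sup x y) = f y"
    using lattice_hom_onD(3)[OF assms(1,4,5)] by (simp add: sup.absorb2)
  then have "sup x y = y"
    using assms sublatticeD(6)[OF assms(2,4,5)] by (auto dest: inj_onD)
  then show "x \<le> y" by (metis sup.cobounded1)
qed (rule lattice_hom_on_mono[OF assms(1,4,5)])

lemma sublattice_range:
  fixes f :: "'a::vector_lattice \<Rightarrow> 'b::vector_lattice"
  assumes "lattice_hom_on UNIV f"
  shows "sublattice (range f)"
proof -
  have "0 \<in> range f"
    using lattice_hom_onD(2)[OF assms, of 0 0] by (metis UNIV_I rangeI scaleR_zero_left)
  moreover have "f x + f y \<in> range f" "r *\<^sub>R f x \<in> range f"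
      "sup (f x) (f y) \<in> range f" "inf (f x) (f y) \<in> range f" for x y r
    using lattice_hom_onD[OF assms] by (metis UNIV_I rangeI)+
  ultimately show ?thesis
    unfolding sublattice_def subspace_def by auto
qed

text \<open>Order dense sublattices preserve infima. If a lower bound \<open>w\<close> of the image
  had a nonzero positive part, order density would put some \<open>f x\<close> > 0 below it, and
  \<open>x\<close> would be a strictly positive lower bound of \<open>A\<close> in
  \<open>S\<close>.\<close>

lemma order_dense_isGlb_zero:
  fixes f :: "'a::vector_lattice \<Rightarrow> 'b::vector_lattice"
  assumes hom: "lattice_hom_on S f" and S: "sublattice S" and inj: "inj_on f S"
    and dense: "order_dense (f ` S)" and A: "A \<subseteq> S" and glb: "isGlb S A 0"
  shows "isGlb UNIV (f ` A) 0"
proof -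
  note f0 = lattice_hom_on_zero[OF hom S]
  note le_iff = lattice_hom_on_le_iff[OF hom S inj]
  have nonneg: "0 \<le> f a" if "a \<in> A" for a
    using that glb A le_iff[of 0 a] sublatticeD(1)[OF S] f0 by (auto simp: isGlb_iff)
  have "w \<le> 0" if w: "\<And>a. a \<in> A \<Longrightarrow> w \<le> f a" for w
  proof (rule ccontr)
    assume "\<not> w \<le> 0"
    then have "0 < sup w 0"
      by (metis sup.cobounded1 sup.cobounded2 order.not_eq_order_implies_strict)
    then obtain x where x: "x \<in> S" "0 < f x" "f x \<le> sup w 0"
      using dense unfolding order_dense_def by blast
    have "x \<le> a" if "a \<in> A" for a
    proof -
      have "f x \<le> f a"
        \<comment> \<open>The images are nonnegative, so not only \<open>w\<close> but also
          \<open>sup w 0\<close> is a lower bound of them.\<close>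
        using x(3) sup_least[OF w nonneg] that by (meson order_trans)
      then show ?thesis using le_iff x(1) that A by blast
    qed
    then have "x \<le> 0" using glb x(1) by (auto simp: isGlb_iff)
    then have "f x \<le> 0"
      using le_iff[of x 0] x(1) sublatticeD(1)[OF S] f0 by auto
    with x(2) show False by simp
  qed
  with nonneg show ?thesis by (auto simp: isGlb_iff)
qed

text \<open>The map \<open>f\<close> stands for the embedding of the larger lattice, restricted to
  \<open>Y\<close>. Regularity enters as order continuity at 0, \<open>continuous_f\<close>;
  translation carries it to other points.\<close>

locale completion_extension =
  fixes Y :: "'a::vector_lattice set"
    and \<iota> :: "'a \<Rightarrow> 'c::order_complete_vector_lattice"
    and f :: "'a \<Rightarrow> 'b::order_complete_vector_lattice"
  assumes completion: "order_completion Y \<iota>"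
    and hom_f: "lattice_hom_on Y f"
    and continuous_f: "A \<subseteq> Y \<Longrightarrow> isGlb Y A 0 \<Longrightarrow> isGlb UNIV (f ` A) 0"
begin

section \<open>The cut in \<open>Y\<close> determined by an element of its completion\<close>

definition lower :: "'c \<Rightarrow> 'a set" where
  "lower z = {l \<in> Y. \<iota> l \<le> z}"

definition upper :: "'c \<Rightarrow> 'a set" where
  "upper z = {u \<in> Y. z \<le> \<iota> u}"

text \<open>\<open>Inf\<close> is meaningful only for nonempty sets that are bounded below. Here
  \<open>upper_nonempty\<close> gives the former, and \<open>lower_nonempty\<close> with
  \<open>lower_le_upper\<close> the latter.\<close>

definition extension :: "'c \<Rightarrow> 'b" where
  "extension z = Inf (f ` upper z)"

lemma
  shows sublattice_Y: "sublattice Y"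
    and hom: "lattice_hom_on Y \<iota>"
    and inj: "inj_on \<iota> Y"
    and dense: "order_dense (\<iota> ` Y)"
    and majorizing: "majorizing (\<iota> ` Y)"
  using completion unfolding order_completion_def by auto

lemmas Y_closed = sublatticeD[OF sublattice_Y]
lemmas \<iota>_simps = lattice_hom_onD[OF hom] lattice_hom_on_uminus[OF hom]
  lattice_hom_on_zero[OF hom sublattice_Y] lattice_hom_on_diff[OF hom sublattice_Y]
lemmas f_simps = lattice_hom_onD[OF hom_f] lattice_hom_on_uminus[OF hom_f]
  lattice_hom_on_zero[OF hom_f sublattice_Y] lattice_hom_on_diff[OF hom_f sublattice_Y]
lemmas \<iota>_le_iff = lattice_hom_on_le_iff[OF hom sublattice_Y inj]
lemmas f_mono = lattice_hom_on_mono[OF hom_f]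

text \<open>Reflection at 0 swaps the two halves of the cut, so facts about one half yield their
  duals.\<close>

lemma lower_uminus: "l \<in> lower (- z) \<longleftrightarrow> - l \<in> upper z"
  unfolding lower_def upper_def using Y_closed(5)[of l] Y_closed(5)[of "- l"]
  by (auto simp: \<iota>_simps le_minus_iff)

lemma upper_uminus: "u \<in> upper (- z) \<longleftrightarrow> - u \<in> lower z"
  using lower_uminus[of "- u" "- z"] by simp

lemma upper_nonempty: "upper z \<noteq> {}"
proof (cases "z \<le> 0")
  case True
  then have "0 \<in> upper z"
    unfolding upper_def by (simp add: \<iota>_simps Y_closed)
  then show ?thesis by auto
next
  case False
  \<comment> \<open>Majorizing speaks of strictly positive elements only, hence the passage to the
    positive part.\<close>
  then have "0 < sup z 0"
    by (metis sup.cobounded1 sup.cobounded2 order.not_eq_order_implies_strict)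
  then obtain u where "u \<in> Y" "sup z 0 \<le> \<iota> u"
    using majorizing unfolding majorizing_def by blast
  then have "u \<in> upper z" unfolding upper_def by simp
  then show ?thesis by auto
qed

lemma lower_nonempty: "lower z \<noteq> {}"
  using upper_nonempty[of "- z"] upper_uminus[of _ z] by auto

lemma lower_le_upper: "l \<in> lower z \<Longrightarrow> u \<in> upper z \<Longrightarrow> f l \<le> f u"
  unfolding lower_def upper_def using \<iota>_le_iff f_mono by fastforce

text \<open>Thus \<open>z\<close> is the supremum of the elements of \<open>Y\<close> below it.
  Otherwise order density places some \<open>\<iota> y\<close> > 0 in the gap between
  \<open>inf w z\<close> and \<open>z\<close>; adding \<open>y\<close> never leaves
  \<open>lower z\<close>, so all multiples of \<open>\<iota> y\<close> are bounded, against the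
  Archimedean property.\<close>

lemma lower_least:
  assumes w: "\<And>l. l \<in> lower z \<Longrightarrow> \<iota> l \<le> w"
  shows "z \<le> w"
proof (rule ccontr)
  assume "\<not> z \<le> w"
  then have "0 < z - inf w z"
    by (metis diff_gt_0_iff_gt inf.cobounded1 inf.cobounded2 order.not_eq_order_implies_strict)
  then obtain y where y: "y \<in> Y" "0 < \<iota> y" "\<iota> y \<le> z - inf w z"
    using dense unfolding order_dense_def by blast
  have step: "l + y \<in> lower z" if "l \<in> lower z" for l
  proof -
    have "\<iota> l \<le> inf w z" using w[OF that] that unfolding lower_def by auto
    then have "\<iota> l + \<iota> y \<le> inf w z + (z - inf w z)" using y(3) by (rule add_mono)
    then have "\<iota> l + \<iota> y \<le> z" by (simp only: add.commute[of "inf w z"] diff_add_cancel)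
    then show ?thesis
      using that y(1) unfolding lower_def by (auto simp: \<iota>_simps Y_closed)
  qed
  obtain l where l: "l \<in> lower z" using lower_nonempty by blast
  have iterate: "l + real n *\<^sub>R y \<in> lower z" for n
  proof (induction n)
    case (Suc n)
    from step[OF Suc] show ?case by (simp add: algebra_simps)
  qed (use l in simp)
  have "real n *\<^sub>R \<iota> y \<le> z - \<iota> l" for n
    using iterate[of n] l y(1) unfolding lower_def
    by (auto simp: \<iota>_simps Y_closed le_diff_eq add.commute)
  then have "\<iota> y \<le> 0" by (rule order_complete_archimedean)
  with y(2) show False by simp
qed

lemma upper_greatest:
  assumes "\<And>u. u \<in> upper z \<Longrightarrow> w \<le> \<iota> u"
  shows "w \<le> z"
proof -
  have "\<iota> l \<le> - w" if "l \<in> lower (- z)" for l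
    using assms[of "- l"] that lower_uminus
    by (metis (mono_tags, lifting) \<iota>_simps(5) le_minus_iff lower_def mem_Collect_eq)
  then have "- z \<le> - w" by (rule lower_least)
  then show ?thesis by simp
qed

text \<open>Let \<open>y\<close> be a lower bound. For fixed \<open>l\<close>,
  \<open>\<iota> l + \<iota> y\<close> lies below every \<open>\<iota> u\<close>, hence below
  \<open>z\<close>. Letting \<open>l\<close> vary, \<open>z - \<iota> y\<close> bounds all
  \<open>\<iota> l\<close>, hence \<open>z\<close>, which forces \<open>y\<close> \<le> 0.\<close>

lemma gap_isGlb: "isGlb Y {u - l | u l. u \<in> upper z \<and> l \<in> lower z} 0"
proof -
  have nonpos: "y \<le> 0"
    if y: "y \<in> Y" "\<And>u l. u \<in> upper z \<Longrightarrow> l \<in> lower z \<Longrightarrow> y \<le> u - l" for y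
  proof -
    have "\<iota> l \<le> z - \<iota> y" if l: "l \<in> lower z" for l
    proof -
      have "\<iota> l + \<iota> y \<le> z"
      proof (rule upper_greatest)
        fix u assume u: "u \<in> upper z"
        have Y: "u \<in> Y" "l \<in> Y" using u l unfolding upper_def lower_def by auto
        have "\<iota> y \<le> \<iota> (u - l)"
          using y(2)[OF u l] \<iota>_le_iff[OF y(1) Y_closed(4)[OF Y]] by simp
        then show "\<iota> l + \<iota> y \<le> \<iota> u" using Y by (simp add: \<iota>_simps le_diff_eq add.commute)
      qed
      then show ?thesis by (simp add: le_diff_eq)
    qed
    then have "z \<le> z - \<iota> y" by (rule lower_least)
    then have "\<iota> y \<le> \<iota> 0" by (simp add: \<iota>_simps)
    then show "y \<le> 0" using \<iota>_le_iff[OF y(1) Y_closed(1)] by simp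
  qed
  have nonneg: "0 \<le> u - l" if "u \<in> upper z" "l \<in> lower z" for u l
  proof -
    have "l \<in> Y" "u \<in> Y" "\<iota> l \<le> \<iota> u"
      using that order_trans[of "\<iota> l" z "\<iota> u"] unfolding upper_def lower_def by simp_all
    then show ?thesis using \<iota>_le_iff[of l u] by simp
  qed
  show ?thesis
    unfolding isGlb_iff
  proof (intro conjI ballI impI)
    fix b assume "b \<in> Y" and b: "\<forall>x\<in>{u - l | u l. u \<in> upper z \<and> l \<in> lower z}. b \<le> x"
    show "b \<le> 0"
    proof (rule nonpos[OF \<open>b \<in> Y\<close>])
      fix u l assume "u \<in> upper z" "l \<in> lower z"
      then show "b \<le> u - l" using b by blast
    qed
  qed (use Y_closed(1) nonneg in blast)+
qed

lemma gap_least: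
  assumes "\<And>u l. u \<in> upper z \<Longrightarrow> l \<in> lower z \<Longrightarrow> w \<le> f u - f l"
  shows "w \<le> 0"
proof -
  let ?D = "{u - l | u l. u \<in> upper z \<and> l \<in> lower z}"
  have "?D \<subseteq> Y" unfolding upper_def lower_def using Y_closed(4) by auto
  then have "isGlb UNIV (f ` ?D) 0" using gap_isGlb by (rule continuous_f)
  moreover have "w \<le> f (u - l)" if "u \<in> upper z" "l \<in> lower z" for u l
  proof -
    have "u \<in> Y" "l \<in> Y" using that unfolding upper_def lower_def by auto
    then show ?thesis using assms[OF that] by (simp add: f_simps)
  qed
  then have "w \<le> x" if "x \<in> f ` ?D" for x
    using that by auto
  ultimately show ?thesis by (rule isGlb_greatest)
qed

section \<open>Values of the extension as infimum, supremum and unique separating element\<close>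

lemma extension_le:
  assumes "u \<in> upper z"
  shows "extension z \<le> f u"
  unfolding extension_def
proof (rule cInf_lower)
  obtain l where "l \<in> lower z" using lower_nonempty by blast
  then show "bdd_below (f ` upper z)" using lower_le_upper by (intro bdd_belowI2)
qed (use assms in simp)

lemma extension_greatest:
  assumes "\<And>u. u \<in> upper z \<Longrightarrow> w \<le> f u"
  shows "w \<le> extension z"
  unfolding extension_def
proof (rule cInf_greatest)
  show "f ` upper z \<noteq> {}" using upper_nonempty by simp
qed (use assms in blast)

lemma le_extension: "l \<in> lower z \<Longrightarrow> f l \<le> extension z"
  by (intro extension_greatest lower_le_upper)

text \<open>The difference \<open>extension z - w\<close> lies below every gap
  \<open>f u - f l\<close>, and these have infimum 0 by \<open>gap_least\<close>. The reverse
  inequality is the infimum property of \<open>extension z\<close>.\<close>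

lemma extension_unique:
  assumes low: "\<And>l. l \<in> lower z \<Longrightarrow> f l \<le> w"
    and up: "\<And>u. u \<in> upper z \<Longrightarrow> w \<le> f u"
  shows "extension z = w"
proof (rule order.antisym)
  have "extension z - w \<le> 0"
    by (rule gap_least[of z]) (intro diff_mono extension_le low)
  then show "extension z \<le> w" by simp
qed (rule extension_greatest[OF up])

lemma extension_least:
  assumes "\<And>l. l \<in> lower z \<Longrightarrow> f l \<le> w"
  shows "extension z \<le> w"
proof -
  \<comment> \<open>Meeting with \<open>extension z\<close> keeps the bound \<open>w\<close> below
    all \<open>f u\<close>, so that uniqueness applies.\<close>
  have "extension z = inf w (extension z)"
    by (rule extension_unique) (simp_all add: assms le_extension extension_le le_infI2)
  then show ?thesis by (metis inf.cobounded1)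
qed

text \<open>Two independent infima are taken one after the other, each time with the other summand
  moved across the inequality.\<close>

lemma extension_add_greatest:
  assumes "\<And>u v. u \<in> upper x \<Longrightarrow> v \<in> upper y \<Longrightarrow> w \<le> f u + f v"
  shows "w \<le> extension x + extension y"
proof -
  have "w - extension y \<le> extension x"
  proof (rule extension_greatest)
    fix u assume u: "u \<in> upper x"
    have "w - f u \<le> extension y"
      using assms[OF u] by (intro extension_greatest) (simp add: algebra_simps)
    then show "w - extension y \<le> f u" by (simp add: algebra_simps)
  qed
  then show ?thesis by (simp add: algebra_simps)
qed

lemma extension_add_least:
  assumes "\<And>u v. u \<in> lower x \<Longrightarrow> v \<in> lower y \<Longrightarrow> f u + f v \<le> w"
  shows "extension x + extension y \<le> w"
proof -
  have "extension x \<le> w - extension y"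
  proof (rule extension_least)
    fix u assume u: "u \<in> lower x"
    have "extension y \<le> w - f u"
      using assms[OF u] by (intro extension_least) (simp add: algebra_simps)
    then show "f u \<le> w - extension y" by (simp add: algebra_simps)
  qed
  then show ?thesis by (simp add: algebra_simps)
qed

section \<open>The extension as a lattice homomorphism\<close>

lemma extension_\<iota>: "y \<in> Y \<Longrightarrow> extension (\<iota> y) = f y"
  by (rule extension_unique) (auto simp: lower_def upper_def \<iota>_le_iff intro: f_mono)

lemma extension_add: "extension (x + y) = extension x + extension y"
proof (rule extension_unique)
  fix l assume l: "l \<in> lower (x + y)"
  show "f l \<le> extension x + extension y"
  proof (rule extension_add_greatest)
    fix u v assume uv: "u \<in> upper x" "v \<in> upper y"
    have Y: "l \<in> Y" "u \<in> Y" "v \<in> Y" using l uv unfolding lower_def upper_def by auto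
    have "\<iota> l \<le> \<iota> (u + v)"
      using l uv add_mono[of x "\<iota> u" y "\<iota> v"] unfolding lower_def upper_def
      by (auto simp: \<iota>_simps)
    then have "f l \<le> f (u + v)" using Y by (simp add: \<iota>_le_iff f_mono Y_closed)
    then show "f l \<le> f u + f v" using Y by (simp add: f_simps)
  qed
next
  fix l assume l: "l \<in> upper (x + y)"
  show "extension x + extension y \<le> f l"
  proof (rule extension_add_least)
    fix u v assume uv: "u \<in> lower x" "v \<in> lower y"
    have Y: "l \<in> Y" "u \<in> Y" "v \<in> Y" using l uv unfolding lower_def upper_def by auto
    have "\<iota> (u + v) \<le> \<iota> l"
      using l uv add_mono[of "\<iota> u" x "\<iota> v" y] unfolding lower_def upper_def
      by (auto simp: \<iota>_simps)
    then have "f (u + v) \<le> f l" using Y by (simp add: \<iota>_le_iff f_mono Y_closed)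
    then show "f u + f v \<le> f l" using Y by (simp add: f_simps)
  qed
qed

lemma extension_zero: "extension 0 = 0"
  using extension_add[of 0 0] by simp

lemma extension_uminus: "extension (- x) = - extension x"
  using extension_add[of x "- x"] extension_zero by (simp add: eq_neg_iff_add_eq_0 add.commute)

lemma extension_diff: "extension (x - y) = extension x - extension y"
  using extension_add[of x "- y"] extension_uminus[of y] by simp

text \<open>Division by \<open>r\<close> > 0 carries the cut of \<open>r *\<^sub>R x\<close> to the
  cut of \<open>x\<close>, so \<open>r *\<^sub>R extension x\<close> separates the former.\<close>

lemma extension_scaleR_pos:
  assumes "0 < r"
  shows "extension (r *\<^sub>R x) = r *\<^sub>R extension x"
proof (rule extension_unique)
  fix l assume l: "l \<in> lower (r *\<^sub>R x)"
  then have "inverse r *\<^sub>R l \<in> lower x"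
    using assms unfolding lower_def
    by (auto simp: Y_closed \<iota>_simps pos_divideR_le_eq[symmetric])
  from scaleR_left_mono[OF le_extension[OF this], of r] l assms
  show "f l \<le> r *\<^sub>R extension x"
    unfolding lower_def by (auto simp: f_simps)
next
  fix u assume u: "u \<in> upper (r *\<^sub>R x)"
  then have "inverse r *\<^sub>R u \<in> upper x"
    using assms unfolding upper_def
    by (auto simp: Y_closed \<iota>_simps pos_le_divideR_eq)
  from scaleR_left_mono[OF extension_le[OF this], of r] u assms
  show "r *\<^sub>R extension x \<le> f u"
    unfolding upper_def by (auto simp: f_simps)
qed

lemma extension_scaleR: "extension (r *\<^sub>R x) = r *\<^sub>R extension x"
proof (cases r "0::real" rule: linorder_cases)
  case less
  have "extension (- ((- r) *\<^sub>R x)) = - ((- r) *\<^sub>R extension x)"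
    using extension_scaleR_pos[of "- r" x] less extension_uminus by simp
  then show ?thesis by simp
qed (simp_all add: extension_zero extension_scaleR_pos)

lemma extension_sup: "extension (sup x y) = sup (extension x) (extension y)"
proof (rule extension_unique)
  fix l assume l: "l \<in> lower (sup x y)"
  \<comment> \<open>Adding \<open>extension x + extension y\<close> to the estimate from
    \<open>sup_diff_le\<close> leaves \<open>f u + f v\<close> as the only dependence on
    \<open>u\<close> and \<open>v\<close>, and the infimum over both can be taken.\<close>
  have "f l + (extension x + extension y) - sup (extension x) (extension y)
      \<le> extension x + extension y"
  proof (rule extension_add_greatest)
    fix u v assume uv: "u \<in> upper x" "v \<in> upper y"
    have Y: "l \<in> Y" "u \<in> Y" "v \<in> Y" using l uv unfolding lower_def upper_def by auto
    have "\<iota> l \<le> \<iota> (sup u v)"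
      using l uv sup_mono[of x "\<iota> u" y "\<iota> v"] unfolding lower_def upper_def
      by (auto simp: \<iota>_simps intro: order_trans)
    then have "f l \<le> sup (f u) (f v)"
      using Y f_mono[of l "sup u v"] by (simp add: \<iota>_le_iff f_simps Y_closed)
    also have "\<dots> \<le> sup (extension x) (extension y) + (f u - extension x) + (f v - extension y)"
      using uv by (intro sup_diff_le extension_le)
    finally have "f l + (extension x + extension y)
        \<le> sup (extension x) (extension y) + (f u + f v)"
      by (simp add: algebra_simps)
    then show "f l + (extension x + extension y) - sup (extension x) (extension y) \<le> f u + f v"
      by (simp only: diff_le_eq add.commute)
  qed
  then have "f l + (extension x + extension y)
      \<le> sup (extension x) (extension y) + (extension x + extension y)"
    by (simp only: diff_le_eq add.commute)
  then show "f l \<le> sup (extension x) (extension y)"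
    by (simp only: add_le_cancel_right)
next
  fix u assume "u \<in> upper (sup x y)"
  then show "sup (extension x) (extension y) \<le> f u"
    by (auto simp: upper_def intro: extension_le)
qed

lemma extension_inf: "extension (inf x y) = inf (extension x) (extension y)"
  using extension_sup[of "- x" "- y"] by (simp add: extension_uminus flip: neg_inf_eq_sup)

lemma lattice_hom_extension: "lattice_hom_on UNIV extension"
  unfolding lattice_hom_on_def
  by (simp add: extension_add extension_scaleR extension_sup extension_inf)

section \<open>Injectivity and regularity of the range\<close>

lemma inj_extension:
  assumes "inj_on f Y"
  shows "inj extension"
proof -
  have nonpos: "z \<le> 0" if "extension z = 0" for z
  proof (rule ccontr)
    assume "\<not> z \<le> 0"
    then have "0 < sup z 0"
      by (metis sup.cobounded1 sup.cobounded2 order.not_eq_order_implies_strict)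
    \<comment> \<open>The extension also kills the positive part of \<open>z\<close>, so
      \<open>f y\<close> \<le> 0 will contradict the injectivity of \<open>f\<close> on
      \<open>Y\<close>.\<close>
    then obtain y where y: "y \<in> Y" "0 < \<iota> y" "\<iota> y \<le> sup z 0"
      using dense unfolding order_dense_def by blast
    have "f y \<le> extension (sup z 0)"
      using y by (intro le_extension) (simp add: lower_def)
    then have "f y \<le> f 0"
      by (simp add: extension_sup extension_zero that f_simps)
    then have "y \<le> 0"
      using lattice_hom_on_le_iff[OF hom_f sublattice_Y assms] y(1) Y_closed(1) by blast
    then have "\<iota> y \<le> \<iota> 0" using \<iota>_le_iff y(1) Y_closed(1) by blast
    with y(2) show False by (simp add: \<iota>_simps)
  qed
  show ?thesis
  proof (rule injI)
    fix x y assume "extension x = extension y"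
    then have "x - y \<le> 0" "y - x \<le> 0" by (simp_all only: nonpos extension_diff diff_self)
    then show "x = y" by simp
  qed
qed

text \<open>Every \<open>c\<close> is the infimum of the elements of \<open>Y\<close> above it, so
  their union \<open>?D\<close> over all \<open>c\<close> in \<open>C\<close> has infimum 0 in
  \<open>Y\<close>, and \<open>continuous_f\<close> applies. A lower bound of the values
  \<open>extension c\<close> also bounds \<open>f\<close> on \<open>?D\<close>, since
  \<open>extension c\<close> \<le> \<open>f u\<close>.\<close>

lemma extension_isGlb_zero:
  assumes glb: "isGlb UNIV C 0"
  shows "isGlb UNIV (extension ` C) 0"
proof -
  let ?D = "\<Union>c\<in>C. upper c"
  have D: "?D \<subseteq> Y" unfolding upper_def by auto
  have "y \<le> 0" if y: "y \<in> Y" "\<And>u. u \<in> ?D \<Longrightarrow> y \<le> u" for y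
  proof -
    have "\<iota> y \<le> c" if "c \<in> C" for c
    proof (rule upper_greatest)
      fix u assume "u \<in> upper c"
      then show "\<iota> y \<le> \<iota> u" using y that D \<iota>_le_iff by blast
    qed
    then have "\<iota> y \<le> \<iota> 0" using glb by (simp add: isGlb_iff \<iota>_simps)
    then show ?thesis using \<iota>_le_iff y(1) Y_closed(1) by blast
  qed
  moreover have "0 \<le> u" if u: "u \<in> ?D" for u
  proof -
    have "\<iota> 0 \<le> \<iota> u"
      using glb u by (auto simp: isGlb_iff \<iota>_simps upper_def intro: order_trans)
    then show ?thesis using \<iota>_le_iff u D Y_closed(1) by blast
  qed
  ultimately have "isGlb Y ?D 0" unfolding isGlb_iff using Y_closed(1) by blast
  then have least: "w \<le> 0" if "\<And>u. u \<in> ?D \<Longrightarrow> w \<le> f u" for w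
    by (rule isGlb_greatest[OF continuous_f[OF D]]) (use that in blast)+
  have "w \<le> 0" if w: "\<And>c. c \<in> C \<Longrightarrow> w \<le> extension c" for w
    using w extension_le by (intro least) (blast intro: order_trans)
  moreover have "0 \<le> extension c" if "c \<in> C" for c
    using lattice_hom_on_mono[OF lattice_hom_extension, of 0 c] glb that extension_zero
    by (auto simp: isGlb_iff)
  ultimately show ?thesis by (auto simp: isGlb_iff)
qed

lemma regular_range_extension:
  assumes "inj_on f Y"
  shows "regular_sublattice (range extension)"
  unfolding regular_sublattice_def
proof (intro conjI allI impI)
  show "sublattice (range extension)" by (rule sublattice_range[OF lattice_hom_extension])
next
  fix A a assume A: "A \<subseteq> range extension" and glb: "isGlb (range extension) A a"
  have "sublattice (UNIV :: 'c set)" by (simp add: sublattice_def)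
  then have le_iff: "extension x \<le> extension y \<longleftrightarrow> x \<le> y" for x y
    using lattice_hom_on_le_iff[OF lattice_hom_extension _ inj_extension[OF assms]] by simp
  obtain B where B: "A = extension ` B" using A by (auto simp: subset_image_iff)
  obtain b where b: "a = extension b" using glb by (auto simp: isGlb_iff)
  \<comment> \<open>The extension is an order isomorphism onto its range, so the infimum pulls back
    to \<open>b\<close>; translation by \<open>b\<close> then reduces to infimum 0.\<close>
  have "isGlb UNIV ((\<lambda>x. x - b) ` B) 0"
    using glb unfolding B b
    by (auto simp: isGlb_iff le_iff le_diff_eq)
  then have "isGlb UNIV (extension ` (\<lambda>x. x - b) ` B) 0" by (rule extension_isGlb_zero)
  then have least: "w \<le> 0" if "\<And>x. x \<in> B \<Longrightarrow> w \<le> extension x - a" for w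
    using that by (auto simp: isGlb_iff b extension_diff)
  have "w \<le> a" if "\<And>x. x \<in> B \<Longrightarrow> w \<le> extension x" for w
    using least[of "w - a"] that by (simp add: diff_right_mono)
  then show "isGlb UNIV A a" using glb unfolding B by (auto simp: isGlb_iff)
qed

end

theorem theorem2p10:
  fixes Y :: "'a::archimedean_vector_lattice set"
    and \<iota>\<^sub>X :: "'a \<Rightarrow> 'b::order_complete_vector_lattice"
    and \<iota>\<^sub>Y :: "'a \<Rightarrow> 'c::order_complete_vector_lattice"
  assumes "regular_sublattice Y"
    and "order_completion UNIV \<iota>\<^sub>X"
    and "order_completion Y \<iota>\<^sub>Y"
  shows "\<exists>\<phi> :: 'c \<Rightarrow> 'b.
           lattice_hom_on UNIV \<phi> \<and> inj \<phi> \<and>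
           (\<forall>y\<in>Y. \<phi> (\<iota>\<^sub>Y y) = \<iota>\<^sub>X y) \<and>
           regular_sublattice (range \<phi>)"
proof -
  have X: "lattice_hom_on UNIV \<iota>\<^sub>X" "sublattice (UNIV :: 'a set)" "inj \<iota>\<^sub>X"
      "order_dense (range \<iota>\<^sub>X)"
    using assms(2) unfolding order_completion_def by auto
  interpret completion_extension Y \<iota>\<^sub>Y \<iota>\<^sub>X
  proof
    show "order_completion Y \<iota>\<^sub>Y" by (rule assms(3))
    show "lattice_hom_on Y \<iota>\<^sub>X" using X(1) unfolding lattice_hom_on_def by auto
    fix A assume "A \<subseteq> Y" "isGlb Y A 0"
    \<comment> \<open>The infimum passes from \<open>Y\<close> to the whole lattice by regularity,
      then to its completion by order density.\<close>
    then have "isGlb UNIV A 0" using assms(1) unfolding regular_sublattice_def by blast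
    then show "isGlb UNIV (\<iota>\<^sub>X ` A) 0" by (rule order_dense_isGlb_zero[OF X subset_UNIV])
  qed
  have "inj_on \<iota>\<^sub>X Y" using X(3) by (rule inj_on_subset) simp
  then show ?thesis
    using lattice_hom_extension inj_extension extension_\<iota> regular_range_extension by blast
qed

end
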